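(* Let $X$ be a nontrivial real Banach space, let $C\subseteq X$ be nonempty, convex and closed, and let $F,G:C\times C\to\mathbb{R}$ be monotone bifunctions fulfilling $F(x,x)=G(x,x)=0$ for all $x\in C$, such that for all $x\in C$ the functions $F(x,\cdot)$ and $G(x,\cdot)$ are convex and lower semicontinuous. If $0\in\operatorname{sqri}(C-C)$, then $A^F+A^G=A^{F+G}$.
   Context: $X^*$ is the topological dual of $X$ and $\langle x^*,x\rangle$ the value of $x^*\in X^*$ at $x\in X$. For a convex set $U\subseteq X$, $\operatorname{sqri}(U)=\{x\in U:\operatorname{cone}(U-x)\text{ is a closed linear subspace}\}$, where $\operatorname{cone}$ denotes the conical hull. A bifunction $F:C\times C\to\mathbb{R}$ is monotone if $F(x,y)+F(y,x)\le 0$ for all $x,y\in C$. The operator $A^F:X\rightrightarrows X^*$ is defined by $A^F(x)=\{x^*\in X^*:F(x,y)-F(x,x)\ge\langle x^*,y-x\rangle\ \forall y\in C\}$ if $x\in C$ and $A^F(x)=\emptyset$ if $x\notin C$ (and similarly for $G$ and $F+G$). The sum $A^F+A^G$ is taken pointwise: $(A^F+A^G)(x)=A^F(x)+A^G(x)$. *)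

theory Defs
  imports "HOL-Analysis.Analysis" "HOL-Library.Set_Algebras"
begin

definition sqri :: "'a::real_normed_vector set \<Rightarrow> 'a set" where
  "sqri U = {x \<in> U. closed (cone hull ((\<lambda>u. u - x) ` U)) \<and> subspace (cone hull ((\<lambda>u. u - x) ` U))}"

(* On sets, the infix minus is the relative complement, not the algebraic difference. *)
definition minkowski_diff :: "'a::ab_group_add set \<Rightarrow> 'a set \<Rightarrow> 'a set" where
  "minkowski_diff A B = {a - b | a b. a \<in> A \<and> b \<in> B}"

(* Lower semicontinuity of the restriction of f to S, in the relative topology of S.
   When S is closed this is the same as lower semicontinuity on the whole space of the
   extension of f by plus infinity outside S. *)
definition lsc_on :: "'a::topological_space set \<Rightarrow> ('a \<Rightarrow> real) \<Rightarrow> bool" where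
  "lsc_on S f \<longleftrightarrow> (\<forall>x\<in>S. \<forall>r < f x. eventually (\<lambda>y. r < f y) (at x within S))"

(* A bifunction C \<times> C \<rightarrow> R is represented by a total curried function whose values
   outside C \<times> C are never used. *)
definition monotone_bifunction :: "'a set \<Rightarrow> ('a \<Rightarrow> 'a \<Rightarrow> real) \<Rightarrow> bool" where
  "monotone_bifunction C F \<longleftrightarrow> (\<forall>x\<in>C. \<forall>y\<in>C. F x y + F y x \<le> 0)"

(* The topological dual of 'a is the type of bounded linear functionals on 'a. *)
definition bifunction_operator ::
  "'a::real_normed_vector set \<Rightarrow> ('a \<Rightarrow> 'a \<Rightarrow> real) \<Rightarrow> 'a \<Rightarrow> ('a \<Rightarrow>\<^sub>L real) set" where
  "bifunction_operator C F x =
     (if x \<in> C then {xs. \<forall>y\<in>C. F x y - F x x \<ge> blinfun_apply xs (y - x)} else {})"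

end

theory Submission
  imports Defs
begin

text \<open>Given \<open>x\<^sup>*\<close> in the operator of \<open>F + G\<close> at \<open>x\<close>, put \<open>f = F x\<close> and
  \<open>g = G x - x\<^sup>*(\<cdot> - x)\<close>, so that \<open>f + g \<ge> 0\<close> on \<open>C\<close>. It suffices to find a bounded functional \<open>u\<close>
  with \<open>u (a - b) \<le> f a + g b\<close> for all \<open>a, b \<in> C\<close>: then \<open>x\<^sup>* = u + (x\<^sup>* - u)\<close> is the required
  splitting. This is Attouch--Brezis duality. The closed subspace \<open>cone (C - C)\<close> is covered by multiples
  of the images of the closed convex bounded sets where \<open>f a + g b \<le> n\<close>, so by Baire and
  completeness one of these images contains a ball of that subspace. Convexity turns this into
  \<open>f a + g b + K \<parallel>a - b\<parallel> \<ge> 0\<close>, and Hahn--Banach (a minimal sublinear functional is linear)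
  yields \<open>u\<close> with \<open>\<parallel>u\<parallel> \<le> K\<close>.\<close>

section \<open>Sublinear functionals and the Hahn--Banach theorem\<close>

text \<open>Homogeneity is required only as an inequality, which is what infima deliver directly;
  scaling back by \<open>inverse c\<close> recovers equality in
  \<open>sublinear_scaleR\<close>.\<close>

definition sublinear :: "('a::real_vector \<Rightarrow> real) \<Rightarrow> bool" where
  "sublinear q \<longleftrightarrow> (\<forall>x y. q (x + y) \<le> q x + q y) \<and> (\<forall>c x. 0 \<le> c \<longrightarrow> q (c *\<^sub>R x) \<le> c * q x)"

lemma sublinear_add: "sublinear q \<Longrightarrow> q (x + y) \<le> q x + q y"
  and sublinear_scaleR_le: "sublinear q \<Longrightarrow> 0 \<le> c \<Longrightarrow> q (c *\<^sub>R x) \<le> c * q x"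
  by (auto simp: sublinear_def)

lemma sublinear_zero: "sublinear q \<Longrightarrow> q 0 = 0"
  using sublinear_add[of q 0 0] sublinear_scaleR_le[of q 0 0] by simp

lemma sublinear_minus: "sublinear q \<Longrightarrow> - q (- x) \<le> q x"
  using sublinear_add[of q x "-x"] sublinear_zero[of q] by simp

lemma sublinear_scaleR:
  assumes "sublinear q" "0 \<le> c"
  shows "q (c *\<^sub>R x) = c * q x"
proof (cases "c = 0")
  case True
  then show ?thesis using sublinear_zero[OF assms(1)] by simp
next
  case False
  with assms have c: "c > 0" by simp
  have "q (inverse c *\<^sub>R (c *\<^sub>R x)) \<le> inverse c * q (c *\<^sub>R x)"
    using c by (intro sublinear_scaleR_le[OF assms(1)]) simp
  then have "c * q x \<le> q (c *\<^sub>R x)"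
    using c by (simp add: field_simps)
  with sublinear_scaleR_le[OF assms, of x] show ?thesis by simp
qed

text \<open>Inequalities between elements of the sets pass to the infima. All sublinear functions
  below arise this way: the perturbation of a minimal one, the infimum of a chain, and the infimal
  convolution with a norm.\<close>

lemma sublinear_Inf:
  fixes S :: "'a::real_vector \<Rightarrow> real set"
  assumes ne: "\<And>x. S x \<noteq> {}" and bdd: "\<And>x. bdd_below (S x)"
    and add: "\<And>x y a b. a \<in> S x \<Longrightarrow> b \<in> S y \<Longrightarrow> \<exists>s\<in>S (x + y). s \<le> a + b"
    and scale: "\<And>x a c. a \<in> S x \<Longrightarrow> 0 \<le> c \<Longrightarrow> \<exists>s\<in>S (c *\<^sub>R x). s \<le> c * a"
  shows "sublinear (\<lambda>x. Inf (S x))"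
  unfolding sublinear_def
proof (intro conjI allI impI)
  fix x y
  have sum: "Inf (S (x + y)) \<le> a + b" if "a \<in> S x" "b \<in> S y" for a b
    using add[OF that] cInf_lower[OF _ bdd] by force
  have "Inf (S (x + y)) - b \<le> Inf (S x)" if "b \<in> S y" for b
    using sum[OF _ that] by (intro cInf_greatest[OF ne]) (simp add: diff_le_eq)
  then have "Inf (S (x + y)) - Inf (S x) \<le> Inf (S y)"
    by (intro cInf_greatest[OF ne]) (simp add: algebra_simps)
  then show "Inf (S (x + y)) \<le> Inf (S x) + Inf (S y)" by simp
next
  fix c :: real and x
  assume c: "0 \<le> c"
  have mult: "Inf (S (c *\<^sub>R x)) \<le> c * a" if "a \<in> S x" for a
    using scale[OF that c] cInf_lower[OF _ bdd] by force
  show "Inf (S (c *\<^sub>R x)) \<le> c * Inf (S x)"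
  proof (cases "c = 0")
    case True
    then show ?thesis using mult ne[of x] by auto
  next
    case False
    then have "Inf (S (c *\<^sub>R x)) / c \<le> Inf (S x)"
      using c mult by (intro cInf_greatest[OF ne]) (simp add: field_simps)
    then show ?thesis using c False by (simp add: field_simps)
  qed
qed

text \<open>For fixed \<open>v\<close>, the function \<open>w \<mapsto> inf {q (w + t v) - t q v | t \<ge> 0}\<close> is sublinear and below \<open>q\<close>;
  minimality makes it equal to \<open>q\<close>, and \<open>t = 1\<close> then gives superadditivity.\<close>
lemma minimal_sublinear_linear:
  assumes q: "sublinear q" and min: "\<And>r. sublinear r \<Longrightarrow> r \<le> q \<Longrightarrow> r = q"
  shows "linear q"
proof -
  have super: "q w + q v \<le> q (w + v)" for v w
  proof -
    define S where "S w = {q (w + t *\<^sub>R v) - t * q v | t. 0 \<le> t}" for w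
    have bdd: "bdd_below (S x)" for x
    proof (rule bdd_belowI)
      fix s assume "s \<in> S x"
      then obtain t where t: "0 \<le> t" "s = q (x + t *\<^sub>R v) - t * q v" by (auto simp: S_def)
      \<comment> \<open>This lower bound does not depend on \<open>t\<close>, since
        \<open>t * q v = q (t *\<^sub>R v)\<close>.\<close>
      have "q (t *\<^sub>R v) \<le> q (x + t *\<^sub>R v) + q (- x)"
        using sublinear_add[OF q, of "x + t *\<^sub>R v" "- x"] by simp
      then show "- q (- x) \<le> s"
        using t sublinear_scaleR[OF q t(1), of v] by simp
    qed
    have "sublinear (\<lambda>x. Inf (S x))"
    proof (rule sublinear_Inf[OF _ bdd])
      show "S x \<noteq> {}" for x by (auto simp: S_def)
    next
      fix x y a b assume "a \<in> S x" "b \<in> S y"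
      then obtain s t where st: "0 \<le> s" "a = q (x + s *\<^sub>R v) - s * q v"
        "0 \<le> t" "b = q (y + t *\<^sub>R v) - t * q v" by (auto simp: S_def)
      have "q ((x + y) + (s + t) *\<^sub>R v) - (s + t) * q v \<in> S (x + y)"
        using st by (auto simp: S_def intro!: exI[of _ "s + t"])
      moreover have "q ((x + y) + (s + t) *\<^sub>R v) - (s + t) * q v \<le> a + b"
        using sublinear_add[OF q, of "x + s *\<^sub>R v" "y + t *\<^sub>R v"] st
        by (simp add: algebra_simps)
      ultimately show "\<exists>s\<in>S (x + y). s \<le> a + b" by blast
    next
      fix x a and c :: real assume "a \<in> S x" and c: "0 \<le> c"
      then obtain t where t: "0 \<le> t" "a = q (x + t *\<^sub>R v) - t * q v" by (auto simp: S_def)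
      have "q (c *\<^sub>R x + (c * t) *\<^sub>R v) - (c * t) * q v \<in> S (c *\<^sub>R x)"
        using t c by (auto simp: S_def)
      moreover have "q (c *\<^sub>R x + (c * t) *\<^sub>R v) - (c * t) * q v \<le> c * a"
        using sublinear_scaleR[OF q c, of "x + t *\<^sub>R v"] t by (simp add: scaleR_add_right right_diff_distrib)
      ultimately show "\<exists>s\<in>S (c *\<^sub>R x). s \<le> c * a" by blast
    qed
    moreover have le: "Inf (S x) \<le> q (x + t *\<^sub>R v) - t * q v" if "0 \<le> t" for x t
      using that by (intro cInf_lower[OF _ bdd]) (auto simp: S_def)
    have "(\<lambda>x. Inf (S x)) \<le> q"
      using le[of 0] by (simp add: le_fun_def)
    ultimately have "(\<lambda>x. Inf (S x)) = q" by (rule min)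
    then have "Inf (S w) = q w" by metis
    then show ?thesis using le[of 1 w] by simp
  qed
  have add: "q (x + y) = q x + q y" for x y
    using super[of x y] sublinear_add[OF q, of x y] by simp
  have neg: "q (- x) = - q x" for x
    using add[of x "- x"] sublinear_zero[OF q] by simp
  show ?thesis
  proof (rule linearI[OF add])
    fix c x
    show "q (c *\<^sub>R x) = c *\<^sub>R q x"
    proof (cases "0 \<le> c")
      case True
      then show ?thesis using sublinear_scaleR[OF q] by simp
    next
      case False
      then show ?thesis using sublinear_scaleR[OF q, of "- c" x] neg[of "c *\<^sub>R x"] by simp
    qed
  qed
qed

text \<open>Zorn's lemma yields a minimal sublinear function below \<open>p\<close>, and minimal
  ones are linear. Pointwise infima of chains stay finite because every sublinear
  \<open>q \<le> p\<close> satisfies \<open>- p (- x) \<le> - q (- x) \<le> q x\<close>.\<close>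

theorem hahn_banach_sublinear:
  assumes p: "sublinear p"
  obtains u where "linear u" "\<And>x. u x \<le> p x"
proof -
  define A where "A = {q. sublinear q \<and> q \<le> p}"
  have "\<exists>m\<in>A. \<forall>a\<in>A. m \<ge> a \<longrightarrow> a = m"
  proof (rule predicate_Zorn)
    show "partial_order_on A (relation_of (\<ge>) A)"
      by (rule partial_order_on_relation_ofI) auto
  next
    fix \<C> assume "\<C> \<in> Chains (relation_of (\<ge>) A)"
    then have rel: "q \<in> A \<and> (q \<le> r \<or> r \<le> q)" if "q \<in> \<C>" "r \<in> \<C>" for q r
      using that unfolding Chains_def relation_of_def by blast
    then have sub: "q \<in> A" if "q \<in> \<C>" for q
      using that by blast
    show "\<exists>u\<in>A. \<forall>a\<in>\<C>. a \<ge> u"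
    proof (cases "\<C> = {}")
      case True
      then show ?thesis using p by (auto simp: A_def)
    next
      case False
      define S where "S x = (\<lambda>q. q x) ` \<C>" for x
      have bdd: "bdd_below (S x)" for x
      proof (rule bdd_belowI)
        fix s assume "s \<in> S x"
        then obtain q where q: "q \<in> \<C>" "s = q x" by (auto simp: S_def)
        then have "sublinear q" "q (- x) \<le> p (- x)" using sub by (auto simp: A_def le_fun_def)
        then show "- p (- x) \<le> s" using sublinear_minus[of q x] q by simp
      qed
      have le: "Inf (S x) \<le> q x" if "q \<in> \<C>" for q x
        using that by (intro cInf_lower[OF _ bdd]) (auto simp: S_def)
      have "sublinear (\<lambda>x. Inf (S x))"
      proof (rule sublinear_Inf[OF _ bdd])
        show "S x \<noteq> {}" for x using False by (auto simp: S_def)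
      next
        fix x y a b assume "a \<in> S x" "b \<in> S y"
        then obtain q r where qr: "q \<in> \<C>" "a = q x" "r \<in> \<C>" "b = r y" by (auto simp: S_def)
        \<comment> \<open>Subadditivity of the infimum needs one member of the chain below both
          \<open>q\<close> and \<open>r\<close>; comparability makes the smaller of the two
          suitable.\<close>
        have "\<exists>s\<in>\<C>. s \<le> q \<and> s \<le> r" using rel[OF qr(1,3)] qr by auto
        then obtain s where s: "s \<in> \<C>" "s \<le> q" "s \<le> r" by blast
        then have "s (x + y) \<le> s x + s y" using sub by (auto simp: A_def sublinear_add)
        also have "\<dots> \<le> a + b" using s qr by (simp add: le_fun_def add_mono)
        finally show "\<exists>s\<in>S (x + y). s \<le> a + b" using s(1) by (auto simp: S_def)
      next
        fix x a and c :: real assume "a \<in> S x" and c: "0 \<le> c"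
        then show "\<exists>s\<in>S (c *\<^sub>R x). s \<le> c * a"
          using sub unfolding S_def A_def by (blast intro: sublinear_scaleR_le)
      qed
      moreover have "(\<lambda>x. Inf (S x)) \<le> p"
      proof -
        obtain q where "q \<in> \<C>" using False by blast
        then show ?thesis
          using sub[of q] le[of q] by (auto simp: A_def le_fun_def intro: order_trans)
      qed
      ultimately have "(\<lambda>x. Inf (S x)) \<in> A" by (simp add: A_def)
      then show ?thesis using le by (auto simp: le_fun_def intro!: bexI[of _ "\<lambda>x. Inf (S x)"])
    qed
  qed
  then obtain m where m: "sublinear m" "m \<le> p" "\<And>a. sublinear a \<Longrightarrow> a \<le> p \<Longrightarrow> a \<le> m \<Longrightarrow> a = m"
    by (auto simp: A_def)
  have "linear m"
    by (rule minimal_sublinear_linear) (use m order_trans in blast)+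
  then show ?thesis using that[of m] m(2) by (auto simp: le_fun_def)
qed

section \<open>Bounded functionals from a lower bound by a norm\<close>

text \<open>Hahn--Banach is applied to the function \<open>Inf (S w)\<close> below. In the resulting
  estimate for \<open>u\<close>, \<open>t = 0\<close> gives \<open>u w \<le> K * norm w\<close>,
  hence continuity, while \<open>t = 1\<close> and \<open>w = T d\<close> give the minorant.\<close>

lemma bounded_multiplier:
  fixes T :: "'b::real_vector \<Rightarrow> 'a::real_normed_vector" and \<phi> :: "'b \<Rightarrow> real"
  assumes T: "linear T" and \<phi>: "convex_on D \<phi>" and "D \<noteq> {}" and K: "0 \<le> K"
    and lower: "\<And>d. d \<in> D \<Longrightarrow> 0 \<le> \<phi> d + K * norm (T d)"
  obtains u :: "'a \<Rightarrow>\<^sub>L real" where "\<And>d. d \<in> D \<Longrightarrow> blinfun_apply u (T d) \<le> \<phi> d"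
proof -
  obtain d\<^sub>0 where d0: "d\<^sub>0 \<in> D" using \<open>D \<noteq> {}\<close> by blast
  \<comment> \<open>The infimum of \<open>S w\<close> is the infimal convolution of the conical hull of the value function with
    \<open>K * norm\<close>; the norm term makes it finite everywhere and forces every linear minorant to be bounded.\<close>
  define S where "S w = {t * \<phi> d + K * norm (w - t *\<^sub>R T d) | t d. 0 \<le> t \<and> d \<in> D}" for w
  have bdd: "bdd_below (S w)" for w
  proof (rule bdd_belowI)
    fix s assume "s \<in> S w"
    then obtain t d where td: "0 \<le> t" "d \<in> D" and s: "s = t * \<phi> d + K * norm (w - t *\<^sub>R T d)"
      by (auto simp: S_def)
    have "t *\<^sub>R T d = w - (w - t *\<^sub>R T d)" by simp
    then have "t * norm (T d) \<le> norm w + norm (w - t *\<^sub>R T d)"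
      using td by (metis abs_of_nonneg norm_scaleR norm_triangle_ineq4)
    from mult_left_mono[OF this K] mult_left_mono[OF lower[OF td(2)] td(1)]
    show "- (K * norm w) \<le> s" by (simp add: s algebra_simps)
  qed
  have "sublinear (\<lambda>w. Inf (S w))"
  proof (rule sublinear_Inf[OF _ bdd])
    show "S x \<noteq> {}" for x using d0 by (auto simp: S_def)
  next
    fix x y a b assume "a \<in> S x" "b \<in> S y"
    then obtain s d t e where sd: "0 \<le> s" "d \<in> D" "0 \<le> t" "e \<in> D"
      and a: "a = s * \<phi> d + K * norm (x - s *\<^sub>R T d)"
      and b: "b = t * \<phi> e + K * norm (y - t *\<^sub>R T e)"
      by (auto simp: S_def)
    \<comment> \<open>Two multiples of points of \<open>D\<close> merge into one multiple of their
      convex combination with weights proportional to \<open>s\<close> and \<open>t\<close>; if both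
      vanish, any point of \<open>D\<close> serves.\<close>
    obtain r where r: "r \<in> D" "(s + t) * \<phi> r \<le> s * \<phi> d + t * \<phi> e"
      "(s + t) *\<^sub>R T r = s *\<^sub>R T d + t *\<^sub>R T e"
    proof (cases "s + t = 0")
      case True
      then have "s = 0" "t = 0" using sd by auto
      then show ?thesis using sd that[of d] by simp
    next
      case False
      with sd have pos: "s + t > 0" by simp
      define r where "r = (s / (s + t)) *\<^sub>R d + (t / (s + t)) *\<^sub>R e"
      have one: "s / (s + t) + t / (s + t) = 1" using pos by (simp add: add_divide_distrib[symmetric])
      have "r \<in> D"
        unfolding r_def using convex_on_imp_convex[OF \<phi>] sd pos one by (intro convexD) auto
      moreover have "\<phi> r \<le> s / (s + t) * \<phi> d + t / (s + t) * \<phi> e"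
        unfolding r_def using \<phi> sd pos one by (simp add: convex_on_def del: times_divide_eq_left)
      then have "\<phi> r \<le> (s * \<phi> d + t * \<phi> e) / (s + t)"
        by (simp add: add_divide_distrib)
      then have "(s + t) * \<phi> r \<le> s * \<phi> d + t * \<phi> e"
        using pos by (simp add: pos_le_divide_eq mult.commute)
      moreover have "(s + t) *\<^sub>R T r = s *\<^sub>R T d + t *\<^sub>R T e"
        using pos by (simp add: r_def linear_add[OF T] linear_scale[OF T] scaleR_add_right)
      ultimately show ?thesis by (rule that)
    qed
    have "norm ((x + y) - (s + t) *\<^sub>R T r) \<le> norm (x - s *\<^sub>R T d) + norm (y - t *\<^sub>R T e)"
      using norm_triangle_ineq[of "x - s *\<^sub>R T d" "y - t *\<^sub>R T e"] unfolding r(3) by (simp add: algebra_simps)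
    from mult_left_mono[OF this K] r(2)
    have "(s + t) * \<phi> r + K * norm ((x + y) - (s + t) *\<^sub>R T r) \<le> a + b"
      by (simp add: a b algebra_simps)
    moreover have "(s + t) * \<phi> r + K * norm ((x + y) - (s + t) *\<^sub>R T r) \<in> S (x + y)"
      unfolding S_def using sd r(1) by (intro CollectI exI[of _ "s + t"] exI[of _ r]) auto
    ultimately show "\<exists>s\<in>S (x + y). s \<le> a + b" by blast
  next
    fix x a and c :: real assume "a \<in> S x" and c: "0 \<le> c"
    then obtain t d where td: "0 \<le> t" "d \<in> D" and a: "a = t * \<phi> d + K * norm (x - t *\<^sub>R T d)"
      by (auto simp: S_def)
    have "norm (c *\<^sub>R x - (c * t) *\<^sub>R T d) = c * norm (x - t *\<^sub>R T d)"
      using c by (metis abs_of_nonneg norm_scaleR scaleR_diff_right scaleR_scaleR)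
    then have "(c * t) * \<phi> d + K * norm (c *\<^sub>R x - (c * t) *\<^sub>R T d) = c * a"
      by (simp add: a algebra_simps)
    moreover have "(c * t) * \<phi> d + K * norm (c *\<^sub>R x - (c * t) *\<^sub>R T d) \<in> S (c *\<^sub>R x)"
      unfolding S_def using c td by (intro CollectI exI[of _ "c * t"] exI[of _ d]) auto
    ultimately show "\<exists>s\<in>S (c *\<^sub>R x). s \<le> c * a" by (metis order_refl)
  qed
  then obtain u where u: "linear u" "\<And>w. u w \<le> Inf (S w)"
    by (rule hahn_banach_sublinear) blast
  have le: "u w \<le> t * \<phi> d + K * norm (w - t *\<^sub>R T d)" if "0 \<le> t" "d \<in> D" for w t d
    by (rule order_trans[OF u(2)], rule cInf_lower[OF _ bdd]) (use that in \<open>auto simp: S_def\<close>)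
  have bound: "u w \<le> K * norm w" for w
    using le[of 0 d\<^sub>0 w] d0 by simp
  have "\<bar>u w\<bar> \<le> K * norm w" for w
    using bound[of w] bound[of "- w"] by (simp add: linear_neg[OF u(1)] abs_le_iff)
  then have "bounded_linear u"
    using u(1) by (intro bounded_linear_intro[of u K]) (auto simp: linear_add linear_scale mult.commute)
  then have "blinfun_apply (Blinfun u) (T d) \<le> \<phi> d" if "d \<in> D" for d
    using le[of 1 d "T d"] that by (simp add: bounded_linear_Blinfun_apply)
  then show ?thesis by (rule that)
qed

section \<open>Baire category and successive approximation\<close>

text \<open>By Baire, some rescaled closure has a relative interior point \<open>y\<^sub>0\<close>.
  Combining a ball around it with a multiple of \<open>- y\<^sub>0\<close>, absorbed by another set,
  moves the centre to the origin.\<close>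

lemma Baire_absorbing:
  fixes L :: "'a::banach set"
  assumes L: "subspace L" "closed L"
    and E: "\<And>n. convex (E n)" "\<And>m n. m \<le> n \<Longrightarrow> E m \<subseteq> E n"
    and absorb: "\<And>y. y \<in> L \<Longrightarrow> \<exists>n. y /\<^sub>R Suc n \<in> E n"
  obtains \<delta> N where "\<delta> > 0" "\<And>z. z \<in> L \<Longrightarrow> norm z < \<delta> \<Longrightarrow> z \<in> closure (E N)"
proof -
  \<comment> \<open>By \<open>absorb\<close> these relatively closed sets cover \<open>L\<close>;
    \<open>Suc n\<close> avoids division by zero.\<close>
  define A where "A n = L \<inter> (\<lambda>y. y /\<^sub>R Suc n) -` closure (E n)" for n
  have "\<exists>n. top_of_set L interior_of A n \<noteq> {}"
  proof (rule ccontr)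
    assume "\<not> ?thesis"
    moreover have "closedin (top_of_set L) (A n)" for n
      unfolding A_def
      by (rule continuous_closedin_preimage) (auto intro!: continuous_intros)
    moreover have "completely_metrizable_space (top_of_set L)"
      using L(2) completely_metrizable_space_euclidean
      by (intro completely_metrizable_space_closedin) auto
    ultimately have "top_of_set L interior_of (\<Union>(range A)) = {}"
      by (intro Baire_category_alt) auto
    moreover have "\<Union>(range A) = L"
      using absorb closure_subset by (fastforce simp: A_def)
    ultimately have "L = {}"
      using interior_of_topspace[of "top_of_set L"] by simp
    then show False using subspace_0[OF L(1)] by blast
  qed
  then obtain n y\<^sub>0 where "y\<^sub>0 \<in> top_of_set L interior_of A n" by blast
  then obtain U where U: "openin (top_of_set L) U" "U \<subseteq> A n" "y\<^sub>0 \<in> U"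
    unfolding interior_of_def by blast
  then have y0: "y\<^sub>0 \<in> L" using openin_imp_subset by blast
  from U obtain r where r: "r > 0" "\<And>y. y \<in> L \<Longrightarrow> dist y y\<^sub>0 < r \<Longrightarrow> y \<in> U"
    unfolding openin_euclidean_subtopology_iff by blast
  obtain k where k: "(- y\<^sub>0) /\<^sub>R Suc k \<in> E k"
    using absorb[OF subspace_neg[OF L(1) y0]] by blast
  define N where "N = max n k"
  \<comment> \<open>This is \<open>Suc n + Suc k\<close>, so that the weights
    \<open>Suc n / c\<close> and \<open>Suc k / c\<close> used below sum to 1 and cancel the two
    scalings.\<close>
  define c where "c = real (n + k + 2)"
  have c: "c > 0" by (simp add: c_def)
  have "z \<in> closure (E N)" if z: "z \<in> L" "norm z < r / c" for z
  proof -
    have "norm (c *\<^sub>R z) < r" using z c by (simp add: field_simps)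
    then have "y\<^sub>0 + c *\<^sub>R z \<in> U"
      using L(1) y0 z by (intro r(2)) (auto simp: dist_norm subspace_add subspace_scale)
    then have "(y\<^sub>0 + c *\<^sub>R z) /\<^sub>R Suc n \<in> closure (E n)"
      using U(2) by (auto simp: A_def)
    then have 1: "(y\<^sub>0 + c *\<^sub>R z) /\<^sub>R Suc n \<in> closure (E N)"
      using closure_mono[OF E(2)[of n N]] by (auto simp: N_def)
    have 2: "(- y\<^sub>0) /\<^sub>R Suc k \<in> closure (E N)"
      using k E(2)[of k N] closure_subset by (auto simp: N_def)
    have "(Suc n / c) *\<^sub>R ((y\<^sub>0 + c *\<^sub>R z) /\<^sub>R Suc n) + (Suc k / c) *\<^sub>R ((- y\<^sub>0) /\<^sub>R Suc k)
        \<in> closure (E N)"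
      by (rule convexD[OF convex_closure[OF E(1)] 1 2])
         (use c in \<open>auto simp: c_def add_divide_distrib[symmetric]\<close>)
    also have "(Suc n / c) *\<^sub>R ((y\<^sub>0 + c *\<^sub>R z) /\<^sub>R Suc n) + (Suc k / c) *\<^sub>R ((- y\<^sub>0) /\<^sub>R Suc k)
        = (1 / c) *\<^sub>R (y\<^sub>0 + c *\<^sub>R z) + (1 / c) *\<^sub>R (- y\<^sub>0)"
      by (simp del: of_nat_Suc)
    also have "\<dots> = z" using c by (simp add: scaleR_add_right)
    finally show ?thesis .
  qed
  moreover have "r / c > 0" using r c by simp
  ultimately show ?thesis using that by blast
qed

text \<open>This is the iteration from the open mapping theorem: halving the radius allows the
  closure to be dropped. Boundedness of \<open>D\<close> makes the series converge; convexity and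
  closedness keep its sum in \<open>D\<close>.\<close>

lemma ball_subset_image_of_closure:
  fixes D :: "'b::banach set" and T :: "'b \<Rightarrow> 'a::real_normed_vector"
  assumes D: "convex D" "closed D" "bounded D" and T: "bounded_linear T"
    and L: "subspace L" "T ` D \<subseteq> L"
    and cl: "\<And>z. z \<in> L \<Longrightarrow> norm z < \<delta> \<Longrightarrow> z \<in> closure (T ` D)"
    and z: "z \<in> L" "norm z < \<delta> / 2"
  shows "z \<in> T ` D"
proof -
  interpret T: bounded_linear T by fact
  have "\<delta> > 0" using z(2) norm_ge_zero[of z] by linarith
  have step: "\<exists>d\<in>D. 2 *\<^sub>R (w - T d) \<in> L \<and> norm (2 *\<^sub>R (w - T d)) < \<delta>"
    if w: "w \<in> L" "norm w < \<delta>" for w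
  proof -
    obtain d where d: "d \<in> D" "dist (T d) w < \<delta> / 2"
      using cl[OF w] \<open>\<delta> > 0\<close> by (auto simp: closure_approachable dest!: spec[of _ "\<delta> / 2"])
    then show ?thesis
      using L w by (intro bexI[of _ d]) (auto simp: dist_norm norm_minus_commute intro!: subspace_scale subspace_diff)
  qed
  \<comment> \<open>Doubling the error at each step keeps it of size below \<open>\<delta>\<close>, so \<open>z = T (\<Sum>k. d\<^sub>k / 2\<^sup>k\<^sup>+\<^sup>1)\<close>.\<close>
  define W where "W = {w \<in> L. norm w < \<delta>}"
  have "\<forall>w\<in>W. \<exists>d. d \<in> D \<and> 2 *\<^sub>R (w - T d) \<in> W" using step by (auto simp: W_def)
  then obtain e where e: "\<And>w. w \<in> W \<Longrightarrow> e w \<in> D" "\<And>w. w \<in> W \<Longrightarrow> 2 *\<^sub>R (w - T (e w)) \<in> W"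
    by metis
  \<comment> \<open>The start value \<open>2 *\<^sub>R z\<close> lies in \<open>W\<close> because
    \<open>norm z < \<delta> / 2\<close>.\<close>
  define w where "w = rec_nat (2 *\<^sub>R z) (\<lambda>_ w. 2 *\<^sub>R (w - T (e w)))"
  have w_0: "w 0 = 2 *\<^sub>R z" and w_Suc: "\<And>n. w (Suc n) = 2 *\<^sub>R (w n - T (e (w n)))"
    by (simp_all add: w_def)
  have wW: "w n \<in> W" for n
  proof (induction n)
    case 0
    then show ?case using z L by (auto simp: w_0 W_def subspace_scale)
  next
    case (Suc n)
    then show ?case using e(2) by (simp add: w_Suc)
  qed
  define d where "d n = e (w n)" for n
  have dD: "d n \<in> D" for n using e(1) wW by (simp add: d_def)
  define P where "P n = (\<Sum>k<n. (1/2)^Suc k *\<^sub>R d k)" for n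
  have TP: "T (P n) = z - (1/2)^Suc n *\<^sub>R w n" for n
  proof (induction n)
    case 0
    then show ?case by (simp add: P_def T.zero w_0)
  next
    case (Suc n)
    then show ?case
      by (simp add: P_def T.add T.scaleR w_Suc d_def scaleR_diff_right)
  qed
  \<comment> \<open>The weights in \<open>P n\<close> sum to \<open>1 - (1/2)^n\<close>; any point
    of \<open>D\<close> may carry the missing weight. The induction step averages \<open>d n\<close>
    with that point, hence the generalisation over \<open>d\<^sub>0\<close>.\<close>
  have PD: "P n + (1/2)^n *\<^sub>R d\<^sub>0 \<in> D" if "d\<^sub>0 \<in> D" for n d\<^sub>0
    using that
  proof (induction n arbitrary: d\<^sub>0)
    case 0
    then show ?case by (simp add: P_def)
  next
    case (Suc n)
    have "(1/2) *\<^sub>R d n + (1/2) *\<^sub>R d\<^sub>0 \<in> D"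
      using D(1) dD Suc.prems by (intro convexD) auto
    from Suc.IH[OF this] show ?case by (simp add: P_def algebra_simps)
  qed
  obtain B where B: "\<And>x. x \<in> D \<Longrightarrow> norm x \<le> B" using D(3) by (auto simp: bounded_iff)
  have "summable (\<lambda>k. (1/2)^Suc k *\<^sub>R d k)"
  proof (rule summable_comparison_test)
    show "\<exists>N. \<forall>n\<ge>N. norm ((1/2)^Suc n *\<^sub>R d n) \<le> (1/2)^Suc n * B"
      using B[OF dD] by (intro exI[of _ 0]) (auto intro!: mult_left_mono)
    show "summable (\<lambda>n. (1/2)^Suc n * B)"
      by (intro summable_mult2) (subst summable_Suc_iff, simp)
  qed
  then obtain p where p: "P \<longlonglongrightarrow> p"
    unfolding P_def summable_def sums_def by blast
  have half: "(\<lambda>n. (1/2::real)^n) \<longlonglongrightarrow> 0" by (intro LIMSEQ_realpow_zero) auto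
  \<comment> \<open>The filler term vanishes in the limit, so \<open>p\<close> is a limit of points
    of \<open>D\<close>.\<close>
  have "(\<lambda>n. P n + (1/2)^n *\<^sub>R d 0) \<longlonglongrightarrow> p + 0 *\<^sub>R d 0"
    by (intro tendsto_intros p half)
  then have "p \<in> D"
    using closed_sequentially[OF D(2), of "\<lambda>n. P n + (1/2)^n *\<^sub>R d 0"] PD[OF dD] by simp
  moreover have "T p = z"
  proof (rule LIMSEQ_unique)
    show "(\<lambda>n. T (P n)) \<longlonglongrightarrow> T p" by (rule T.tendsto[OF p])
    have "(\<lambda>n. (1/2)^Suc n *\<^sub>R w n) \<longlonglongrightarrow> 0"
    proof (rule Lim_null_comparison)
      show "\<forall>\<^sub>F n in sequentially. norm ((1/2)^Suc n *\<^sub>R w n) \<le> (1/2)^Suc n * \<delta>"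
        using wW by (auto simp: W_def less_imp_le intro!: always_eventually mult_left_mono)
      show "(\<lambda>n. (1/2)^Suc n * \<delta>) \<longlonglongrightarrow> 0"
        by (intro tendsto_mult_left_zero LIMSEQ_Suc[OF half])
    qed
    from tendsto_diff[OF tendsto_const this, of z] show "(\<lambda>n. T (P n)) \<longlonglongrightarrow> z"
      unfolding TP by simp
  qed
  ultimately show ?thesis by blast
qed

section \<open>Lower semicontinuity: sublevel sets and sums\<close>

lemma lsc_on_sequentially:
  assumes f: "lsc_on S f" and X: "X \<longlonglongrightarrow> x" "\<And>n. X n \<in> S" and x: "x \<in> S" "r < f x"
  shows "\<forall>\<^sub>F n in sequentially. r < f (X n)"
proof -
  have "\<forall>\<^sub>F y in at x within S. r < f y" using f x by (auto simp: lsc_on_def)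
  then obtain U where U: "open U" "x \<in> U" "\<And>y. y \<in> U \<Longrightarrow> y \<noteq> x \<Longrightarrow> y \<in> S \<Longrightarrow> r < f y"
    by (auto simp: eventually_at_topological)
  have "\<forall>\<^sub>F n in sequentially. X n \<in> U" using X(1) U(1,2) by (rule topological_tendstoD)
  \<comment> \<open>The filter \<open>at x within S\<close> ignores \<open>x\<close> itself; terms
    of the sequence equal to \<open>x\<close> are covered by \<open>r < f x\<close>.\<close>
  then show ?thesis by eventually_elim (use U(3) X(2) x(2) in metis)
qed

lemma closed_lsc_sublevel:
  fixes S :: "'a::first_countable_topology set"
  assumes "closed S" and f: "lsc_on S f"
  shows "closed {x \<in> S. f x \<le> r}"
  unfolding closed_sequential_limits
proof (intro allI impI, elim conjE)
  fix X x assume X: "\<forall>n. X n \<in> {x \<in> S. f x \<le> r}" "X \<longlonglongrightarrow> x"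
  then have x: "x \<in> S" using \<open>closed S\<close> closed_sequentially by blast
  have "f x \<le> r"
  proof (rule ccontr)
    assume "\<not> f x \<le> r"
    then have "\<forall>\<^sub>F n in sequentially. r < f (X n)"
      using X x by (intro lsc_on_sequentially[OF f]) auto
    then show False using X by (auto simp: eventually_sequentially not_less[symmetric])
  qed
  with x show "x \<in> {x \<in> S. f x \<le> r}" by blast
qed

lemma lsc_on_minus_continuous:
  assumes f: "lsc_on S f" and h: "continuous_on S h"
  shows "lsc_on S (\<lambda>x. f x - h x)"
  unfolding lsc_on_def
proof (intro ballI allI impI)
  fix x r assume x: "x \<in> S" and "r < f x - h x"
  then obtain e where e: "e > 0" "r + e < f x - h x" 
    using that[of "(f x - h x - r) / 2"] by (simp add: field_simps)
  have "\<forall>\<^sub>F y in at x within S. r + h x + e < f y"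
    using f x e by (auto simp: lsc_on_def)
  moreover have "\<forall>\<^sub>F y in at x within S. h y < h x + e"
    using h x e by (intro order_tendstoD(2)[of h "h x"]) (auto simp: continuous_on)
  ultimately show "\<forall>\<^sub>F y in at x within S. r < f y - h y" by eventually_elim simp
qed

lemma lsc_on_add_Times:
  assumes f: "lsc_on A f" and g: "lsc_on B g"
  shows "lsc_on (A \<times> B) (\<lambda>(a, b). f a + g b)"
  unfolding lsc_on_def
proof (intro ballI allI impI)
  fix x r assume x: "x \<in> A \<times> B" and r: "r < (case x of (a, b) \<Rightarrow> f a + g b)"
  obtain a b where ab: "x = (a, b)" "a \<in> A" "b \<in> B" using x by auto
  define e where "e = (f a + g b - r) / 2"
  have e: "e > 0" "r = (f a - e) + (g b - e)" using r by (auto simp: e_def ab field_simps)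
  have "\<forall>\<^sub>F y in at a within A. f a - e < f y" "\<forall>\<^sub>F y in at b within B. g b - e < g y"
    using f g ab e by (auto simp: lsc_on_def)
  then obtain U V where U: "open U" "a \<in> U" "\<And>y. y \<in> U \<Longrightarrow> y \<noteq> a \<Longrightarrow> y \<in> A \<Longrightarrow> f a - e < f y"
    and V: "open V" "b \<in> V" "\<And>y. y \<in> V \<Longrightarrow> y \<noteq> b \<Longrightarrow> y \<in> B \<Longrightarrow> g b - e < g y"
    by (auto simp: eventually_at_topological)
  \<comment> \<open>A point other than \<open>(a, b)\<close> may still agree with it in one
    coordinate, where the punctured neighbourhood gives nothing; there \<open>e > 0\<close>
    suffices.\<close>
  have "r < f a' + g b'" if "(a', b') \<in> U \<times> V" "a' \<in> A" "b' \<in> B" for a' b'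
  proof -
    have "f a - e < f a'" using U(3)[of a'] that e by (cases "a' = a") auto
    moreover have "g b - e < g b'" using V(3)[of b'] that e by (cases "b' = b") auto
    ultimately show ?thesis using e(2) by linarith
  qed
  then show "\<forall>\<^sub>F y in at x within A \<times> B. r < (case y of (a, b) \<Rightarrow> f a + g b)"
    using U V by (auto simp: ab eventually_at_topological open_Times intro!: exI[of _ "U \<times> V"])
qed

section \<open>Attouch--Brezis duality\<close>

text \<open>A Lagrange multiplier for minimising \<phi> subject to \<open>T d = 0\<close>. The
  closed cone condition replaces an interior point condition: it yields a ball of the subspace over
  which \<phi> is bounded above, which produces the constant for
  \<open>bounded_multiplier\<close>.\<close>

theorem closed_cone_multiplier:
  fixes T :: "'b::banach \<Rightarrow> 'a::banach" and \<phi> :: "'b \<Rightarrow> real"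
  assumes T: "bounded_linear T" and D: "closed D"
    and \<phi>: "convex_on D \<phi>" "lsc_on D \<phi>"
    and L: "subspace (cone hull (T ` D))" "closed (cone hull (T ` D))"
    and d0: "d\<^sub>0 \<in> D" "T d\<^sub>0 = 0"
    and nonneg: "\<And>d. d \<in> D \<Longrightarrow> T d = 0 \<Longrightarrow> 0 \<le> \<phi> d"
  obtains u :: "'a \<Rightarrow>\<^sub>L real" where "\<And>d. d \<in> D \<Longrightarrow> blinfun_apply u (T d) \<le> \<phi> d"
proof -
  interpret T: bounded_linear T by fact
  define L where "L = cone hull (T ` D)"
  have subL: "subspace L" "closed L" using L by (simp_all add: L_def)
  have TL: "T d \<in> L" if "d \<in> D" for d
    using that hull_subset[of "T ` D" cone] by (auto simp: L_def)
  have convD: "convex D" using \<phi>(1) by (rule convex_on_imp_convex)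
  have conv\<phi>: "\<phi> (s *\<^sub>R d + t *\<^sub>R e) \<le> s * \<phi> d + t * \<phi> e"
    if "d \<in> D" "e \<in> D" "0 \<le> s" "0 \<le> t" "s + t = 1" for s t d e
    using \<phi>(1) that by (auto simp: convex_on_def)
  \<comment> \<open>The level is shifted by \<open>\<phi> d\<^sub>0\<close> and the ball centred at
    \<open>d\<^sub>0\<close> so that \<open>d\<^sub>0\<close> belongs to every
    \<open>H n\<close>.\<close>
  define H where "H n = {d \<in> D. \<phi> d \<le> n + \<phi> d\<^sub>0} \<inter> cball d\<^sub>0 n" for n :: nat
  have HD: "H n \<subseteq> D" for n by (auto simp: H_def)
  have H: "closed (H n)" "convex (H n)" "bounded (H n)" for n
  proof -
    show "closed (H n)"
      unfolding H_def using closed_lsc_sublevel[OF D \<phi>(2)] by (intro closed_Int) auto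
    show "bounded (H n)" unfolding H_def by (intro bounded_Int) simp
    have "convex {d \<in> D. \<phi> d \<le> n + \<phi> d\<^sub>0}"
    proof (rule convexI)
      fix x y and s t :: real
      assume x: "x \<in> {d \<in> D. \<phi> d \<le> n + \<phi> d\<^sub>0}" and y: "y \<in> {d \<in> D. \<phi> d \<le> n + \<phi> d\<^sub>0}"
        and st: "0 \<le> s" "0 \<le> t" "s + t = 1"
      have "\<phi> (s *\<^sub>R x + t *\<^sub>R y) \<le> s * \<phi> x + t * \<phi> y"
        using x y st by (intro conv\<phi>) auto
      also have "\<dots> \<le> n + \<phi> d\<^sub>0" using x y st by (intro convex_bound_le) auto
      finally show "s *\<^sub>R x + t *\<^sub>R y \<in> {d \<in> D. \<phi> d \<le> n + \<phi> d\<^sub>0}"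
        using convexD[OF convD _ _ st] x y by auto
    qed
    then show "convex (H n)" unfolding H_def by (intro convex_Int) auto
  qed
  obtain \<delta> N where \<delta>: "\<delta> > 0" "\<And>z. z \<in> L \<Longrightarrow> norm z < \<delta> \<Longrightarrow> z \<in> closure (T ` H N)"
  proof (rule Baire_absorbing[OF subL])
    show "convex (T ` H n)" for n
      by (rule convex_linear_image[OF T.linear_axioms H(2)])
    show "T ` H m \<subseteq> T ` H n" if "m \<le> n" for m n
      using that by (intro image_mono) (auto simp: H_def)
  next
    fix y assume "y \<in> L"
    then obtain c d where cd: "0 \<le> c" "d \<in> D" "y = c *\<^sub>R T d"
      by (auto simp: L_def cone_hull_expl)
    \<comment> \<open>The bound on \<open>c\<close> makes the weight \<open>t\<close> at most 1; the
      other two place \<open>d\<close> in \<open>H n\<close>. Mixing with \<open>d\<^sub>0\<close>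
      then scales the image by \<open>t\<close>, as \<open>T d\<^sub>0 = 0\<close>.\<close>
    obtain n where n: "max c (max (\<phi> d - \<phi> d\<^sub>0) (dist d\<^sub>0 d)) \<le> real n"
      using real_arch_simple by blast
    define t where "t = c / Suc n"
    have t: "0 \<le> t" "t \<le> 1" using cd n by (auto simp: t_def field_simps)
    have "d \<in> H n" "d\<^sub>0 \<in> H n" using cd n d0 by (auto simp: H_def)
    then have "t *\<^sub>R d + (1 - t) *\<^sub>R d\<^sub>0 \<in> H n"
      using t by (intro convexD[OF H(2)]) auto
    moreover have "T (t *\<^sub>R d + (1 - t) *\<^sub>R d\<^sub>0) = y /\<^sub>R Suc n"
      by (simp add: T.add T.scaleR d0 cd t_def divide_inverse mult.commute)
    ultimately show "\<exists>n. y /\<^sub>R Suc n \<in> T ` H n" by (metis image_eqI)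
  qed blast
  define M where "M = N + \<phi> d\<^sub>0"
  \<comment> \<open>Any radius strictly below \<open>\<delta> / 2\<close> would do.\<close>
  define \<eta> where "\<eta> = \<delta> / 4"
  have \<eta>: "\<eta> > 0" using \<delta>(1) by (simp add: \<eta>_def)
  have M: "M \<ge> 0" using nonneg[OF d0] by (simp add: M_def)
  have lower: "0 \<le> \<phi> d + (M / \<eta>) * norm (T d)" if d: "d \<in> D" for d
  proof (cases "T d = 0")
    case True
    then show ?thesis using nonneg d by simp
  next
    case False
    define s where "s = norm (T d)"
    have s: "s > 0" using False by (simp add: s_def)
    \<comment> \<open>A point \<open>e\<close> with image opposite to \<open>T d\<close> and \<phi>
      at most \<open>M\<close> is sought: a convex combination of \<open>d\<close> and
      \<open>e\<close> is then feasible, so \<open>nonneg\<close> bounds \<open>\<phi> d\<close>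
      from below.\<close>
    have "- (\<eta> / s) *\<^sub>R T d \<in> T ` H N"
    proof (rule ball_subset_image_of_closure[OF H(2,1,3) T subL(1) _ \<delta>(2)])
      show "T ` H N \<subseteq> L" using TL HD by blast
      show "- (\<eta> / s) *\<^sub>R T d \<in> L" using TL[OF d] by (intro subspace_scale[OF subL(1)])
      show "norm (- (\<eta> / s) *\<^sub>R T d) < \<delta> / 2"
        using s \<eta> \<delta>(1) by (simp add: s_def[symmetric]) (simp add: \<eta>_def)
    qed
    then obtain e where e: "e \<in> D" "\<phi> e \<le> M" "T e = - (\<eta> / s) *\<^sub>R T d"
      by (auto simp: H_def M_def)
    \<comment> \<open>The weights solve \<open>a = b * (\<eta> / s)\<close> and
      \<open>a + b = 1\<close>, so the combined image vanishes.\<close>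
    define a b where "a = \<eta> / (s + \<eta>)" and "b = s / (s + \<eta>)"
    have ab: "0 \<le> a" "0 \<le> b" "a + b = 1"
      using s \<eta> by (auto simp: a_def b_def add_divide_distrib[symmetric] add.commute)
    have "T (a *\<^sub>R d + b *\<^sub>R e) = (a - b * (\<eta> / s)) *\<^sub>R T d"
      by (simp add: T.add T.scaleR e algebra_simps)
    also have "a - b * (\<eta> / s) = 0" using s by (simp add: a_def b_def)
    finally have "0 \<le> \<phi> (a *\<^sub>R d + b *\<^sub>R e)"
      using convexD[OF convD d e(1) ab] by (intro nonneg) auto
    also have "\<dots> \<le> a * \<phi> d + b * \<phi> e" by (rule conv\<phi>[OF d e(1) ab])
    also have "\<dots> \<le> a * \<phi> d + b * M" using e(2) ab by (simp add: mult_left_mono)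
    also have "\<dots> = a * (\<phi> d + (M / \<eta>) * s)"
    proof -
      have "b = a * (s / \<eta>)" using \<eta> by (simp add: a_def b_def)
      then show ?thesis by (simp add: algebra_simps)
    qed
    finally have "0 \<le> a * (\<phi> d + (M / \<eta>) * s)" .
    moreover have "a > 0" using \<eta> s by (simp add: a_def)
    ultimately show ?thesis unfolding s_def by (simp only: zero_le_mult_iff) linarith
  qed
  show ?thesis
  proof (rule bounded_multiplier[OF T.linear_axioms \<phi>(1) _ _ lower])
    show "D \<noteq> {}" "0 \<le> M / \<eta>" using d0 M \<eta> by auto
  qed (use that in blast)+
qed

text \<open>With \<open>T (a, b) = a - b\<close> on \<open>C \<times> C\<close>, the constraint
  \<open>T d = 0\<close> describes the diagonal, where the objective is \<open>f x + g x\<close>;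
  the \<open>sqri\<close> condition is the closed cone condition.\<close>

lemma sandwich_on_sqri:
  fixes C :: "'a::banach set"
  assumes C: "closed C" "C \<noteq> {}"
    and f: "convex_on C f" "lsc_on C f" and g: "convex_on C g" "lsc_on C g"
    and sqri: "0 \<in> sqri (minkowski_diff C C)"
    and nonneg: "\<And>x. x \<in> C \<Longrightarrow> 0 \<le> f x + g x"
  obtains u :: "'a \<Rightarrow>\<^sub>L real"
  where "\<And>a b. a \<in> C \<Longrightarrow> b \<in> C \<Longrightarrow> blinfun_apply u (a - b) \<le> f a + g b"
proof -
  define T :: "'a \<times> 'a \<Rightarrow> 'a" where "T = (\<lambda>(a, b). a - b)"
  have T: "bounded_linear T"
    unfolding T_def case_prod_beta
    by (intro bounded_linear_sub bounded_linear_fst bounded_linear_snd)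
  have TC: "T ` (C \<times> C) = minkowski_diff C C"
    by (auto simp: T_def minkowski_diff_def image_iff)
  have hull: "subspace (cone hull (T ` (C \<times> C)))" "closed (cone hull (T ` (C \<times> C)))"
    using sqri by (simp_all add: sqri_def TC)
  have convex: "convex_on (C \<times> C) (\<lambda>(a, b). f a + g b)"
  proof (rule convex_onI)
    show "convex (C \<times> C)" using f(1) by (intro convex_Times convex_on_imp_convex)
    fix t :: real and x y assume t: "0 < t" "t < 1" and "x \<in> C \<times> C" "y \<in> C \<times> C"
    then obtain a b c d where xy: "x = (a, b)" "y = (c, d)" "a \<in> C" "b \<in> C" "c \<in> C" "d \<in> C"
      by auto
    have "f ((1 - t) *\<^sub>R a + t *\<^sub>R c) \<le> (1 - t) * f a + t * f c"
      using f(1) t xy by (intro convex_onD) auto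
    moreover have "g ((1 - t) *\<^sub>R b + t *\<^sub>R d) \<le> (1 - t) * g b + t * g d"
      using g(1) t xy by (intro convex_onD) auto
    ultimately show "(\<lambda>(a, b). f a + g b) ((1 - t) *\<^sub>R x + t *\<^sub>R y)
        \<le> (1 - t) * (\<lambda>(a, b). f a + g b) x + t * (\<lambda>(a, b). f a + g b) y"
      by (simp add: xy algebra_simps)
  qed
  obtain x where x: "x \<in> C" using C by blast
  obtain u :: "'a \<Rightarrow>\<^sub>L real" where
    u: "\<And>d. d \<in> C \<times> C \<Longrightarrow> blinfun_apply u (T d) \<le> (\<lambda>(a, b). f a + g b) d"
    by (rule closed_cone_multiplier[OF T closed_Times[OF C(1) C(1)] convex
          lsc_on_add_Times[OF f(2) g(2)] hull, of "(x, x)"])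
       (use x nonneg in \<open>auto simp: T_def\<close>)
  show ?thesis
    by (rule that[of u]) (use u in \<open>force simp: T_def\<close>)
qed

section \<open>Sum formula for the operators of bifunctions\<close>

theorem proposition18:
  fixes C :: "'a::banach set" and F G :: "'a \<Rightarrow> 'a \<Rightarrow> real"
  assumes nontrivial: "\<exists>x::'a. x \<noteq> 0"
    and C: "C \<noteq> {}" "convex C" "closed C"
    and mono: "monotone_bifunction C F" "monotone_bifunction C G"
    and diag: "\<And>x. x \<in> C \<Longrightarrow> F x x = 0" "\<And>x. x \<in> C \<Longrightarrow> G x x = 0"
    and conv: "\<And>x. x \<in> C \<Longrightarrow> convex_on C (F x)" "\<And>x. x \<in> C \<Longrightarrow> convex_on C (G x)"
    and lsc: "\<And>x. x \<in> C \<Longrightarrow> lsc_on C (F x)" "\<And>x. x \<in> C \<Longrightarrow> lsc_on C (G x)"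
    and sqri: "0 \<in> sqri (minkowski_diff C C)"
  shows "(\<lambda>x. bifunction_operator C F x + bifunction_operator C G x)
         = bifunction_operator C (\<lambda>x y. F x y + G x y)"
proof
  fix x
  show "bifunction_operator C F x + bifunction_operator C G x
        = bifunction_operator C (\<lambda>x y. F x y + G x y) x"
  proof (cases "x \<in> C")
    case False
    then show ?thesis by (simp add: bifunction_operator_def set_plus_def)
  next
    case x: True
    show ?thesis
    proof (intro set_eqI iffI)
      fix xs assume "xs \<in> bifunction_operator C F x + bifunction_operator C G x"
      then obtain v w where "xs = v + w" "v \<in> bifunction_operator C F x" "w \<in> bifunction_operator C G x"
        by (rule set_plus_elim)
      then show "xs \<in> bifunction_operator C (\<lambda>x y. F x y + G x y) x"
        using x by (force simp: bifunction_operator_def blinfun.add_left)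
    next
      fix xs assume xs: "xs \<in> bifunction_operator C (\<lambda>x y. F x y + G x y) x"
      define h where "h y = blinfun_apply xs (y - x)" for y
      have "convex_on C (\<lambda>y. G x y + - h y)"
        using conv(2)[OF x] C(2)
        by (intro convex_on_add)
           (auto intro!: convex_onI simp: h_def blinfun.bilinear_simps algebra_simps)
      moreover have "lsc_on C (\<lambda>y. G x y - h y)"
        unfolding h_def by (intro lsc_on_minus_continuous lsc x continuous_intros)
      moreover have "0 \<le> F x y + (G x y - h y)" if "y \<in> C" for y
        using xs x that diag by (auto simp: bifunction_operator_def h_def)
      ultimately obtain u :: "'a \<Rightarrow>\<^sub>L real" where
        u: "\<And>a b. a \<in> C \<Longrightarrow> b \<in> C \<Longrightarrow> blinfun_apply u (a - b) \<le> F x a + (G x b - h b)"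
        using sandwich_on_sqri[OF C(3,1) conv(1)[OF x] lsc(1)[OF x] _ _ sqri, of "\<lambda>y. G x y - h y"]
        by auto
      \<comment> \<open>Taking \<open>b = x\<close> leaves only \<open>F x a\<close> on the right,
        since \<open>G x x\<close> and \<open>h x\<close> vanish.\<close>
      have "u \<in> bifunction_operator C F x"
        using u[OF _ x] x diag by (simp add: bifunction_operator_def h_def)
      \<comment> \<open>Taking \<open>a = x\<close> instead gives
        \<open>u (x - b) \<le> G x b - h b\<close>, where \<open>h b = xs (b - x)\<close>.\<close>
      moreover have "xs - u \<in> bifunction_operator C G x"
        using u[OF x] x diag
        by (force simp: bifunction_operator_def h_def blinfun.bilinear_simps)
      ultimately have "u + (xs - u) \<in> bifunction_operator C F x + bifunction_operator C G x"
        by (rule set_plus_intro)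
      then show "xs \<in> bifunction_operator C F x + bifunction_operator C G x" by simp
    qed
  qed
qed

end
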